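(* Let $N$ be a manifold of dimension $n$. Let $f$ be an immersion of $N$ into an open subset $U$ of $\mathbb{R}^m$. Let $F:U\to\mathbb{R}^\ell$ be a mapping. Let $k_0$ be the maximum integer satisfying $(n-v+k_0)(\ell-v+k_0)\le n$, where $v=\min\{n,\ell\}$. Then there exists a subset $\Sigma$ of $\mathcal{L}(\mathbb{R}^m,\mathbb{R}^\ell)$ with Lebesgue measure zero such that for any $\pi\in\mathcal{L}(\mathbb{R}^m,\mathbb{R}^\ell)-\Sigma$, the mapping $F_\pi\circ f:N\to\mathbb{R}^\ell$ has corank at most $k_0$ singular points.
   Context: Conventions: $\ell,m,n$ are positive integers; all manifolds and mappings are of class $C^\infty$ and all manifolds are without boundary. $\mathcal{L}(\mathbb{R}^m,\mathbb{R}^\ell)$ is the space of all linear mappings $\mathbb{R}^m\to\mathbb{R}^\ell$, identified with $(\mathbb{R}^m)^\ell$ (via matrices), which gives it Lebesgue measure. For $\pi\in\mathcal{L}(\mathbb{R}^m,\mathbb{R}^\ell)$ and $F:U\to\mathbb{R}^\ell$, $F_\pi=F+\pi|_U:U\to\mathbb{R}^\ell$. A mapping $g:N\to\mathbb{R}^\ell$ has corank at most $k$ singular points if $\sup\{\operatorname{corank}dg_q\mid q\in N\}\le k$, where $\operatorname{corank}dg_q=\min\{n,\ell\}-\operatorname{rank}dg_q$. *)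

theory Defs
  imports "HOL-Analysis.Analysis"
begin

text \<open>
  \<open>Ck_on k S f\<close> and \<open>smooth_on S f\<close> are meant for open \<open>S\<close>: derivatives are taken with
  respect to the full neighbourhood filter of each point of \<open>S\<close>.
\<close>

fun Ck_on :: "nat \<Rightarrow> 'a::euclidean_space set \<Rightarrow> ('a \<Rightarrow> 'b::euclidean_space) \<Rightarrow> bool" where
  "Ck_on 0 S f \<longleftrightarrow> continuous_on S f"
| "Ck_on (Suc k) S f \<longleftrightarrow>
     (\<forall>x\<in>S. f differentiable (at x)) \<and> (\<forall>v. Ck_on k S (\<lambda>x. frechet_derivative f (at x) v))"

definition smooth_on :: "'a::euclidean_space set \<Rightarrow> ('a \<Rightarrow> 'b::euclidean_space) \<Rightarrow> bool" where
  "smooth_on S f \<longleftrightarrow> (\<forall>k. Ck_on k S f)"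

text \<open>
  A chart is a pair of a domain and a coordinate map; the values of the coordinate map outside
  the domain are irrelevant. The dimension of a manifold is \<open>CARD('n)\<close>.
\<close>

type_synonym ('a, 'n) chart = "'a set \<times> ('a \<Rightarrow> real ^ 'n)"

definition in_chart :: "('a, 'n::finite) chart \<Rightarrow> ('a \<Rightarrow> 'b) \<Rightarrow> real ^ 'n \<Rightarrow> 'b" where
  "in_chart c g = g \<circ> inv_into (fst c) (snd c)"

text \<open>
  The atlas need not be maximal: it determines the smooth structure, and smoothness, tangent
  spaces and differentials below do not depend on which compatible atlas is used.
\<close>

locale smooth_manifold =
  fixes X :: "'a topology" and A :: "('a, 'n::finite) chart set"
  assumes Hausdorff: "Hausdorff_space X"
    and second_countable: "second_countable X"
    and openin_domain: "c \<in> A \<Longrightarrow> openin X (fst c)"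
    and open_range: "c \<in> A \<Longrightarrow> open (snd c ` fst c)"
    and homeomorphic_chart: "c \<in> A \<Longrightarrow>
      homeomorphic_map (subtopology X (fst c)) (top_of_set (snd c ` fst c)) (snd c)"
    and domains_cover: "topspace X = (\<Union>c\<in>A. fst c)"
    and smooth_transition: "c \<in> A \<Longrightarrow> c' \<in> A \<Longrightarrow>
      smooth_on (snd c ` (fst c \<inter> fst c')) (in_chart c (snd c'))"

definition smooth_map :: "('a, 'n::finite) chart set \<Rightarrow> ('a \<Rightarrow> 'b::euclidean_space) \<Rightarrow> bool" where
  "smooth_map A g \<longleftrightarrow> (\<forall>c\<in>A. smooth_on (snd c ` fst c) (in_chart c g))"

definition charts_at :: "('a, 'n::finite) chart set \<Rightarrow> 'a \<Rightarrow> ('a, 'n) chart set" where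
  "charts_at A q = {c \<in> A. q \<in> fst c}"

text \<open>
  A tangent vector at \<open>q\<close> is the family of its coordinate vectors in all charts around \<open>q\<close>,
  which are related by the Jacobians of the transition maps.
\<close>

definition tangent_space ::
  "('a, 'n::finite) chart set \<Rightarrow> 'a \<Rightarrow> (('a, 'n) chart \<Rightarrow> real ^ 'n) set" where
  "tangent_space A q = {v \<in> extensional (charts_at A q).
     \<forall>c\<in>charts_at A q. \<forall>c'\<in>charts_at A q.
       v c' = frechet_derivative (in_chart c (snd c')) (at (snd c q)) (v c)}"

text \<open>
  The choice of chart is immaterial for smooth \<open>g\<close> and tangent \<open>v\<close>, see
  \<open>differential_eq\<close> below. The tangent spaces of the target are identified with the target.
\<close>

definition differential ::
  "('a, 'n::finite) chart set \<Rightarrow> ('a \<Rightarrow> 'b::euclidean_space) \<Rightarrow> 'a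
     \<Rightarrow> (('a, 'n) chart \<Rightarrow> real ^ 'n) \<Rightarrow> 'b" where
  "differential A g q v =
     (let c = (SOME c. c \<in> charts_at A q)
      in frechet_derivative (in_chart c g) (at (snd c q)) (v c))"

lemma (in smooth_manifold) inj_on_chart:
  assumes "c \<in> A" shows "inj_on (snd c) (fst c)"
proof -
  have "fst c \<subseteq> topspace X" using openin_domain[OF assms] openin_subset by blast
  then have "topspace (subtopology X (fst c)) = fst c" by auto
  then show ?thesis
    using homeomorphic_chart[OF assms] by (simp add: homeomorphic_map_def)
qed

lemma (in smooth_manifold) open_overlap:
  assumes "c \<in> A" "c' \<in> A" shows "open (snd c ` (fst c \<inter> fst c'))"
proof -
  let ?S = "subtopology X (fst c)"
  have "openin ?S (fst c \<inter> fst c')"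
    using openin_domain[OF assms(2)] by (rule openin_subtopology_Int2)
  then have "openin (top_of_set (snd c ` fst c)) (snd c ` (fst c \<inter> fst c'))"
    using homeomorphic_imp_open_map[OF homeomorphic_chart[OF assms(1)]]
    by (auto simp: open_map_def)
  then show ?thesis
    using open_range[OF assms(1)] openin_open_trans by blast
qed

lemma smooth_on_imp_differentiable:
  "smooth_on S f \<Longrightarrow> x \<in> S \<Longrightarrow> f differentiable (at x)"
  by (drule smooth_on_def[THEN iffD1], drule spec[of _ "Suc 0"]) (simp only: Ck_on.simps)

lemma (in smooth_manifold) differential_eq:
  fixes g :: "'a \<Rightarrow> 'b::euclidean_space"
  assumes g: "smooth_map A g" and v: "v \<in> tangent_space A q" and c: "c \<in> charts_at A q"
  shows "differential A g q v = frechet_derivative (in_chart c g) (at (snd c q)) (v c)"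
proof -
  define d where "d = (SOME c. c \<in> charts_at A q)"
  have d: "d \<in> charts_at A q" unfolding d_def using c by (rule someI)
  have cA: "c \<in> A" "q \<in> fst c" and dA: "d \<in> A" "q \<in> fst d"
    using c d by (auto simp: charts_at_def)
  let ?W = "snd d ` (fst d \<inter> fst c)" and ?t = "in_chart d (snd c)"
  have W: "open ?W" "snd d q \<in> ?W" using open_overlap[OF dA(1) cA(1)] cA dA by auto
  have inv_d: "inv_into (fst d) (snd d) (snd d p) = p" if "p \<in> fst d" for p
    using inj_on_chart[OF dA(1)] that by (rule inv_into_f_f)
  have inv_c: "inv_into (fst c) (snd c) (snd c p) = p" if "p \<in> fst c" for p
    using inj_on_chart[OF cA(1)] that by (rule inv_into_f_f)
  have tq: "?t (snd d q) = snd c q" using inv_d dA by (simp add: in_chart_def)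
  have "?t differentiable (at (snd d q))"
    using smooth_transition[OF dA(1) cA(1)] W(2) by (rule smooth_on_imp_differentiable)
  then have t: "(?t has_derivative frechet_derivative ?t (at (snd d q))) (at (snd d q))"
    by (rule frechet_derivative_works[THEN iffD1])
  have "in_chart c g differentiable (at (snd c q))"
    using g cA smooth_on_imp_differentiable[of "snd c ` fst c"] by (auto simp: smooth_map_def)
  then have "(in_chart c g has_derivative frechet_derivative (in_chart c g) (at (snd c q)))
      (at (?t (snd d q)))"
    unfolding tq by (rule frechet_derivative_works[THEN iffD1])
  from diff_chain_at[OF t this]
  have "(in_chart d g has_derivative
      frechet_derivative (in_chart c g) (at (snd c q)) \<circ> frechet_derivative ?t (at (snd d q)))
      (at (snd d q))"
    by (rule has_derivative_transform_within_open[OF _ W])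
      (auto simp: in_chart_def inv_d inv_c)
  then have "frechet_derivative (in_chart d g) (at (snd d q)) =
      frechet_derivative (in_chart c g) (at (snd c q)) \<circ> frechet_derivative ?t (at (snd d q))"
    by (rule frechet_derivative_at[symmetric])
  moreover have "v c = frechet_derivative ?t (at (snd d q)) (v d)"
    using v c d unfolding tangent_space_def by blast
  ultimately show ?thesis by (simp add: differential_def d_def[symmetric])
qed

definition immersion_into ::
  "'a topology \<Rightarrow> ('a, 'n::finite) chart set \<Rightarrow> ('a \<Rightarrow> 'b::euclidean_space) \<Rightarrow> 'b set \<Rightarrow> bool" where
  "immersion_into X A f U \<longleftrightarrow>
     smooth_map A f \<and> f ` topspace X \<subseteq> U \<and>
     (\<forall>q\<in>topspace X. inj_on (differential A f q) (tangent_space A q))"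

definition corank ::
  "('a, 'n::finite) chart set \<Rightarrow> ('a \<Rightarrow> real ^ 'l::finite) \<Rightarrow> 'a \<Rightarrow> nat" where
  "corank A g q = min CARD('n) CARD('l) - dim (differential A g q ` tangent_space A q)"

text \<open>
  The supremum is over a set of naturals bounded by \<open>min CARD('n) CARD('l)\<close>; for the empty
  manifold it is \<open>0\<close>.
\<close>

definition corank_at_most_singular ::
  "'a topology \<Rightarrow> ('a, 'n::finite) chart set \<Rightarrow> ('a \<Rightarrow> real ^ 'l::finite) \<Rightarrow> int \<Rightarrow> bool" where
  "corank_at_most_singular X A g k \<longleftrightarrow> int (SUP q\<in>topspace X. corank A g q) \<le> k"

definition perturb :: "('b::euclidean_space \<Rightarrow> 'c::euclidean_space) \<Rightarrow> ('b \<Rightarrow> 'c) \<Rightarrow> 'b \<Rightarrow> 'c" where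
  "perturb F \<pi> = (\<lambda>x. F x + \<pi> x)"

text \<open>A set of linear maps is measured through the identification of linear maps with matrices.\<close>

definition null_set_of_linear_maps :: "(real ^ 'm::finite \<Rightarrow> real ^ 'l::finite) set \<Rightarrow> bool" where
  "null_set_of_linear_maps \<Sigma> \<longleftrightarrow>
     \<Sigma> \<subseteq> {\<pi>. linear \<pi>} \<and> matrix ` \<Sigma> \<in> null_sets (lebesgue :: (real ^ 'm ^ 'l) measure)"

end

theory Submission
  imports Defs
begin

text \<open>
  Fix a chart with image \<open>V\<close> in \<open>\<real>\<^sup>n\<close>. The Jacobian of the perturbed map at \<open>x\<close> is \<open>G x + P ** B x\<close>,
  where \<open>P\<close> is the matrix of \<open>\<pi>\<close>, \<open>B x\<close> is the Jacobian of \<open>f\<close> and \<open>G x\<close> that of \<open>F \<circ> f\<close>. As \<open>f\<close> is an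
  immersion, \<open>B x\<close> is injective, hence \<open>P \<mapsto> G x + P ** B x\<close> is onto all \<open>l \<times> n\<close> matrices, and the
  matrices \<open>P\<close> for which this Jacobian has rank \<open>r\<close> have codimension \<open>(n - r) (l - r)\<close>. Letting \<open>x\<close>
  vary adds \<open>n\<close> dimensions, so if \<open>n < (n - r) (l - r)\<close> then only a null set of matrices \<open>P\<close> has
  rank \<open>r\<close> somewhere on \<open>V\<close>.

  The set of these \<open>P\<close> is negligible because it is covered by countably many images of explicit
  differentiable maps whose parameters range over fewer than \<open>l m\<close> dimensions.
  Lemma \<open>rank_factorization\<close> parametrizes the matrices of rank \<open>r\<close>, \<open>negligible_rank_stratum\<close> combines
  this with coordinates for \<open>x\<close> and for the part of \<open>P\<close> that is free once \<open>P ** B x\<close> is known, and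
  \<open>negligible_low_rank\<close> collects the countably many cases.

  The result for the manifold follows by taking the union over a countable subatlas
  (\<open>negligible_low_rank_perturbations\<close>), since the rank of the differential can be computed in any chart
  (\<open>range_differential\<close>). Finally, \<open>k\<^sub>0\<close> is the maximum of the \<open>k\<close> with
  \<open>(n - v + k) (l - v + k) \<le> n\<close>, so a corank \<open>k > k\<^sub>0\<close>, which is a rank \<open>r = v - k\<close>, satisfies
  \<open>n < (n - r) (l - r)\<close>.
\<close>

section \<open>Differentiability of matrix operations\<close>

lemma differentiable_matrix_iff:
  fixes A :: "'a::euclidean_space \<Rightarrow> real ^ 'n::finite ^ 'l::finite"
  shows "A differentiable (at x within S) \<longleftrightarrow>
    (\<forall>i j. (\<lambda>p. A p $ i $ j) differentiable (at x within S))"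
  unfolding differentiable_componentwise_within[of A]
  by (auto simp: Basis_vec_def inner_axis)

lemma differentiable_matrix_mult:
  fixes A :: "'a::euclidean_space \<Rightarrow> real ^ 'k::finite ^ 'l::finite"
    and B :: "'a \<Rightarrow> real ^ 'n::finite ^ 'k"
  assumes "A differentiable (at x within S)" "B differentiable (at x within S)"
  shows "(\<lambda>p. A p ** B p) differentiable (at x within S)"
  using assms unfolding differentiable_matrix_iff matrix_matrix_mult_def
  by (auto intro!: differentiable_sum differentiable_mult)

lemma differentiable_prod:
  fixes f :: "'i \<Rightarrow> 'a::euclidean_space \<Rightarrow> real"
  assumes "finite I" "\<And>i. i \<in> I \<Longrightarrow> f i differentiable (at x within S)"
  shows "(\<lambda>p. \<Prod>i\<in>I. f i p) differentiable (at x within S)"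
  using assms by (induction I) (auto intro!: differentiable_mult)

lemma differentiable_det:
  fixes A :: "'a::euclidean_space \<Rightarrow> real ^ 'n::finite ^ 'n"
  assumes "A differentiable (at x within S)"
  shows "(\<lambda>p. det (A p)) differentiable (at x within S)"
  using assms unfolding differentiable_matrix_iff det_def
  by (auto intro!: differentiable_sum differentiable_mult differentiable_prod finite_permutations)

lemma matrix_inv_inverse:
  fixes A :: "real ^ 'n::finite ^ 'n"
  assumes "det A \<noteq> 0"
  shows "A ** matrix_inv A = mat 1" "matrix_inv A ** A = mat 1"
proof -
  have "\<exists>B. A ** B = mat 1 \<and> B ** A = mat 1"
    using assms by (simp add: invertible_det_nz[symmetric] invertible_def)
  then have "A ** matrix_inv A = mat 1 \<and> matrix_inv A ** A = mat 1"
    unfolding matrix_inv_def by (rule someI_ex)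
  then show "A ** matrix_inv A = mat 1" "matrix_inv A ** A = mat 1" by auto
qed

text \<open>
  Cramer's rule applied to the columns of the inverse. It makes the entries of the inverse rational
  functions of those of \<open>A\<close>, which is how inversion is seen to be differentiable.
\<close>

lemma matrix_inv_entry:
  fixes A :: "real ^ 'n::finite ^ 'n"
  assumes "det A \<noteq> 0"
  shows "matrix_inv A $ i $ j = det (\<chi> a b. if b = i then axis j 1 $ a else A $ a $ b) / det A"
proof -
  have "A *v (matrix_inv A *v axis j 1) = axis j 1"
    by (simp add: matrix_vector_mul_assoc matrix_inv_inverse[OF assms])
  then have "matrix_inv A *v axis j 1 =
      (\<chi> k. det (\<chi> a b. if b = k then axis j 1 $ a else A $ a $ b) / det A)"
    by (simp add: cramer[OF assms])
  moreover have "(matrix_inv A *v axis j 1) $ i = matrix_inv A $ i $ j"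
    by (simp add: matrix_vector_mult_basis column_def)
  ultimately show ?thesis by simp
qed

lemma differentiable_matrix_inv:
  fixes A :: "'a::euclidean_space \<Rightarrow> real ^ 'n::finite ^ 'n"
  assumes A: "A differentiable (at x within S)" and "x \<in> S" and nz: "\<And>p. p \<in> S \<Longrightarrow> det (A p) \<noteq> 0"
  shows "(\<lambda>p. matrix_inv (A p)) differentiable (at x within S)"
  unfolding differentiable_matrix_iff
proof (intro allI)
  fix i j
  have "(\<lambda>p. \<chi> a b. if b = i then axis j 1 $ a else A p $ a $ b) differentiable (at x within S)"
    unfolding differentiable_matrix_iff
  proof (intro allI)
    fix a b
    show "(\<lambda>p. (\<chi> a b. if b = i then axis j 1 $ a else A p $ a $ b) $ a $ b)
        differentiable (at x within S)"
      using A by (cases "b = i") (auto simp: differentiable_matrix_iff)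
  qed
  from differentiable_divide[OF differentiable_det[OF this] differentiable_det[OF A] nz[OF \<open>x \<in> S\<close>]]
  show "(\<lambda>p. matrix_inv (A p) $ i $ j) differentiable (at x within S)"
    by (rule differentiable_transform_within[OF _ zero_less_one \<open>x \<in> S\<close>])
      (simp add: matrix_inv_entry[OF nz])
qed

section \<open>Images of parameter spaces of small dimension\<close>

text \<open>
  The dimension of the parameter space is a number and not a type here, because it depends on the
  rank of a matrix. The proof moves \<open>T\<close> isometrically onto a proper subspace of the target type,
  which has measure zero; differentiable maps between spaces of equal dimension preserve this.
\<close>

lemma negligible_differentiable_image_subspace:
  fixes \<Phi> :: "'a::euclidean_space \<Rightarrow> 'b::euclidean_space"
  assumes T: "subspace T" and dim: "dim T < DIM('b)" and ST: "S \<subseteq> T"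
    and \<Phi>: "\<Phi> differentiable_on S"
  shows "negligible (\<Phi> ` S)"
proof -
  obtain T' :: "'b set" where T': "subspace T'" "dim T' = dim T"
    using choose_subspace_of_subspace[of "dim T" "UNIV :: 'b set"] dim by (auto simp: dim_UNIV)
  obtain h :: "'a \<Rightarrow> 'b" and k where hk: "linear h" "linear k" "h ` T = T'"
    "\<And>x. x \<in> T \<Longrightarrow> k (h x) = x"
    using isometries_subspaces[OF T T'(1)] T'(2) by metis
  have kh: "k ` h ` S = S"
    using hk(4) ST by (force simp: image_image)
  have "negligible (h ` S)"
  proof (rule negligible_subset)
    show "negligible T'" using T' dim by (intro negligible_lowdim) auto
    show "h ` S \<subseteq> T'" using hk(3) ST by blast
  qed
  moreover have "\<Phi> \<circ> k differentiable_on h ` S"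
    using differentiable_on_compose[of k "h ` S" \<Phi>] linear_imp_differentiable_on[OF hk(2)] \<Phi> kh
    by (simp add: o_def)
  ultimately have "negligible ((\<Phi> \<circ> k) ` h ` S)"
    by (intro negligible_differentiable_image_negligible[OF order_refl])
  then show ?thesis by (simp only: image_comp[symmetric] kh)
qed

text \<open>
  The image of a linear section \<open>s\<close> is a complement of the kernel of \<open>h\<close>.
\<close>

lemma dim_kernel_surjective_le:
  fixes h :: "'a::euclidean_space \<Rightarrow> 'b::euclidean_space"
  assumes "linear h" "linear s" "\<And>y. h (s y) = y"
  shows "dim {x. h x = 0} + DIM('b) \<le> DIM('a)"
proof -
  have k: "subspace {x. h x = 0}" using assms(1) by (rule linear_subspace_kernel)
  have r: "subspace (range s)" using linear_subspace_image[OF assms(2) subspace_UNIV] .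
  have "dim (range s) = DIM('b)"
    using dim_image_eq[of s UNIV] assms by (metis dim_UNIV injI inj_on_subset subset_UNIV)
  moreover have "{x. h x = 0} \<inter> range s = {0}"
    using linear_0[OF assms(1)] linear_0[OF assms(2)] assms(3) by (auto intro: rev_image_eqI[of 0])
  ultimately show ?thesis
    using dim_sums_Int[OF k r] dim_subset_UNIV[of "{x + y |x y. x \<in> {x. h x = 0} \<and> y \<in> range s}"]
    by simp
qed

lemma dim_matrices_supported_on:
  fixes P :: "('l::finite \<times> 'n::finite) set"
  shows "dim {Y :: real ^ 'n ^ 'l. \<forall>i j. (i, j) \<notin> P \<longrightarrow> Y $ i $ j = 0} = card P"
proof -
  let ?e = "\<lambda>(i, j). axis i (axis j 1) :: real ^ 'n ^ 'l"
  have inj: "inj ?e" by (auto simp: inj_def axis_eq_axis)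
  have "{Y :: real ^ 'n ^ 'l. \<forall>i j. (i, j) \<notin> P \<longrightarrow> Y $ i $ j = 0} =
      {Y. \<forall>b\<in>Basis. b \<notin> ?e ` P \<longrightarrow> Y \<bullet> b = 0}"
  proof -
    have "?e (i, j) \<in> ?e ` P \<longleftrightarrow> (i, j) \<in> P" for i j
      using inj by (rule inj_image_mem_iff)
    then show ?thesis by (simp add: Basis_vec_def inner_axis)
  qed
  moreover have "?e ` P \<subseteq> Basis" by (auto simp: Basis_vec_def)
  ultimately show ?thesis
    using dim_substandard[of "?e ` P"] inj by (simp add: card_image inj_on_subset)
qed

lemma subspace_matrices_supported_on:
  "subspace {Y :: real ^ 'n::finite ^ 'l::finite. \<forall>i j. (i, j) \<notin> P \<longrightarrow> Y $ i $ j = 0}"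
  by (auto simp: subspace_def)

section \<open>Matrices of low rank along an immersion\<close>

text \<open>
  Choose columns \<open>J\<close> of \<open>M\<close> that form a basis of the column space. They are the columns of \<open>Y\<close>,
  and \<open>C\<close> contains the coefficients that express the other columns in this basis. For given
  \<open>J\<close>, a matrix of rank \<open>r\<close> thus depends on \<open>l r + r (n - r)\<close> numbers, which is
  \<open>(n - r) (l - r)\<close> fewer than its \<open>l n\<close> entries.
\<close>

lemma rank_factorization:
  fixes M :: "real ^ 'n::finite ^ 'l::finite"
  shows "\<exists>J. card J = rank M \<and> (\<exists>Y C. (\<forall>i j. (i, j) \<notin> UNIV \<times> J \<longrightarrow> Y $ i $ j = 0) \<and>
    (\<forall>i j. (i, j) \<notin> J \<times> - J \<longrightarrow> C $ i $ j = 0) \<and> M = Y ** (mat 1 + C))"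
proof -
  obtain b where b: "b \<subseteq> columns M" "independent b" "columns M \<subseteq> span b" "card b = dim (columns M)"
    using basis_exists by metis
  have cols: "columns M = range (\<lambda>j. column j M)" by (auto simp: columns_def)
  obtain J where J: "inj_on (\<lambda>j. column j M) J" "b = (\<lambda>j. column j M) ` J"
    using b(1) unfolding cols subset_image_inj by auto
  have "\<exists>c. column j M = (\<Sum>i\<in>J. c i *\<^sub>R column i M)" for j
  proof -
    have "column j M \<in> span b" using b(3) cols by blast
    then obtain u where "column j M = (\<Sum>v\<in>b. u v *\<^sub>R v)"
      using span_finite[of b] J(2) by auto
    then show ?thesis unfolding J(2) sum.reindex[OF J(1)] o_def
      by (intro exI[of _ "\<lambda>i. u (column i M)"])
  qed
  then obtain c where c: "\<And>j. column j M = (\<Sum>i\<in>J. c j i *\<^sub>R column i M)" by metis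
  define Y :: "real ^ 'n ^ 'l" where "Y = (\<chi> a j. if j \<in> J then M $ a $ j else 0)"
  define C :: "real ^ 'n ^ 'n" where "C = (\<chi> i j. if i \<in> J \<and> j \<notin> J then c j i else 0)"
  have "card J = rank M"
    using b(4) J card_image[OF J(1)] by (simp add: column_rank_def)
  moreover have "M = Y ** (mat 1 + C)"
  proof -
    have "M $ a $ j = (\<Sum>i\<in>UNIV. Y $ a $ i * ((mat 1 :: real^'n^'n) $ i $ j + C $ i $ j))" for a j
    proof (cases "j \<in> J")
      case True
      then show ?thesis
        by (simp add: Y_def C_def mat_def if_distrib if_distribR cong: if_cong)
    next
      case False
      have "M $ a $ j = column j M $ a" by (simp add: column_def)
      also have "\<dots> = (\<Sum>i\<in>J. c j i * M $ a $ i)"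
        by (subst c) (simp add: column_def)
      also have "\<dots> = (\<Sum>i\<in>UNIV. if i \<in> J then c j i * M $ a $ i else 0)"
        by (simp add: sum.If_cases)
      also have "\<dots> = (\<Sum>i\<in>UNIV. Y $ a $ i * ((mat 1 :: real^'n^'n) $ i $ j + C $ i $ j))"
        using False by (intro sum.cong) (auto simp: Y_def C_def mat_def)
      finally show ?thesis .
    qed
    then show ?thesis by (simp add: vec_eq_iff matrix_matrix_mult_def)
  qed
  ultimately show ?thesis
    by (intro exI[of _ J] conjI exI[of _ Y] exI[of _ C]) (auto simp: Y_def C_def)
qed

lemma linear_matrix_mult_right:
  "linear (\<lambda>A :: real ^ 'k::finite ^ 'l::finite. A ** (B :: real ^ 'n::finite ^ 'k))"
  by (rule linearI) (simp_all add: vec_eq_iff matrix_matrix_mult_def sum.distrib[symmetric]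
      sum_distrib_left algebra_simps)

lemmas matrix_diff_rdistrib = linear_diff[OF linear_matrix_mult_right]

text \<open>
  A matrix \<open>P\<close> is determined by its product with \<open>B x\<close>, whose columns span an \<open>n\<close>-dimensional
  space, and by its restriction to a complement of that space. The matrix \<open>L\<close>
  supplies the complement, its kernel, for all points \<open>x\<close> with \<open>L ** B x\<close> invertible at once.
  With a right inverse \<open>K\<close> of \<open>L\<close>, the restriction of \<open>P\<close> to the kernel is encoded by
  \<open>W = P - P ** (K ** L)\<close>. It satisfies \<open>W ** K = 0\<close>, so it has \<open>l (m - n)\<close> degrees of
  freedom. If \<open>G x + P ** B x\<close> has rank \<open>r = card J\<close> with the columns \<open>J\<close> as a basis, then \<open>P\<close> is a differentiable function of \<open>x\<close>,
  \<open>Y\<close>, \<open>C\<close> and \<open>W\<close>. These are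
  \<open>n + l r + r (n - r) + l (m - n) = l m + n - (n - r) (l - r)\<close> parameters, fewer than the
  \<open>l m\<close> entries of \<open>P\<close>.
\<close>

lemma negligible_rank_stratum:
  fixes B :: "real ^ 'n::finite \<Rightarrow> real ^ 'n ^ 'm::finite" and G :: "real ^ 'n \<Rightarrow> real ^ 'n ^ 'l::finite"
    and L :: "real ^ 'm ^ 'n" and J :: "'n set"
  assumes B: "\<And>x. x \<in> V \<Longrightarrow> B differentiable (at x within V)"
    and G: "\<And>x. x \<in> V \<Longrightarrow> G differentiable (at x within V)"
    and codim: "CARD('n) < (CARD('n) - card J) * (CARD('l) - card J)"
  shows "negligible {P :: real ^ 'm ^ 'l. \<exists>x\<in>V. det (L ** B x) \<noteq> 0 \<and>
    (\<exists>Y C. (\<forall>i j. (i, j) \<notin> UNIV \<times> J \<longrightarrow> Y $ i $ j = 0) \<and>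
      (\<forall>i j. (i, j) \<notin> J \<times> - J \<longrightarrow> C $ i $ j = 0) \<and> G x + P ** B x = Y ** (mat 1 + C))}"
    (is "negligible ?bad")
proof (cases "\<exists>x. det (L ** B x) \<noteq> 0")
  case False
  then show ?thesis by simp
next
  case True
  then obtain z where "det (L ** B z) \<noteq> 0" by blast
  then have "L ** (B z ** matrix_inv (L ** B z)) = mat 1"
    by (simp add: matrix_mul_assoc matrix_inv_inverse)
  then obtain K where K: "L ** K = mat 1" by blast
  define D where "D = {x \<in> V. det (L ** B x) \<noteq> 0}"
  define T where "T x = matrix_inv (L ** B x)" for x
  define VY where "VY = {Y :: real ^ 'n ^ 'l. \<forall>i j. (i, j) \<notin> UNIV \<times> J \<longrightarrow> Y $ i $ j = 0}"
  define VC where "VC = {C :: real ^ 'n ^ 'n. \<forall>i j. (i, j) \<notin> J \<times> - J \<longrightarrow> C $ i $ j = 0}"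
  define VW where "VW = {W :: real ^ 'm ^ 'l. W ** K = 0}"
  \<comment> \<open>For \<open>x \<in> D\<close>, \<open>B x ** (T x ** L)\<close> is the projection onto the column space of \<open>B x\<close> along the
    kernel of \<open>L\<close>. The first summand of \<open>\<Phi>\<close> is the action of \<open>P\<close> on that column space, where
    \<open>P ** B x = Y ** (mat 1 + C) - G x\<close>; the rest is \<open>W\<close> on the kernel.\<close>
  define \<Phi> where "\<Phi> p = (case p of (x, Y, C, W) \<Rightarrow>
      (Y ** (mat 1 + C) - G x) ** (T x ** L) + W - W ** (B x ** (T x ** L)))"
    for p :: "(real ^ 'n) \<times> (real ^ 'n ^ 'l) \<times> (real ^ 'n ^ 'n) \<times> (real ^ 'm ^ 'l)"
  let ?S = "D \<times> VY \<times> VC \<times> VW"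
  let ?T = "(UNIV :: (real ^ 'n) set) \<times> VY \<times> VC \<times> VW"
  have sub: "subspace VY" "subspace VC" "subspace VW"
    unfolding VY_def VC_def VW_def
    by (rule subspace_matrices_supported_on linear_subspace_kernel linear_matrix_mult_right)+
  have dimVW: "dim VW + CARD('l) * CARD('n) \<le> CARD('l) * CARD('m)"
  proof -
    have "(Z ** L) ** K = Z" for Z :: "real ^ 'n ^ 'l"
      by (simp add: matrix_mul_assoc[symmetric] K)
    from dim_kernel_surjective_le[OF linear_matrix_mult_right linear_matrix_mult_right this]
    show ?thesis by (simp add: VW_def mult.commute)
  qed
  have dimVY: "dim VY = CARD('l) * card J"
    unfolding VY_def dim_matrices_supported_on by (simp add: card_cartesian_product)
  have dimVC: "dim VC = card J * (CARD('n) - card J)"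
    unfolding VC_def dim_matrices_supported_on
    by (simp add: card_cartesian_product Compl_eq_Diff_UNIV card_Diff_subset)
  have "dim ?T = CARD('n) + (CARD('l) * card J + (card J * (CARD('n) - card J) + dim VW))"
    using sub by (simp add: dim_Times subspace_Times dimVY dimVC)
  also have "\<dots> < CARD('l) * CARD('m)"
  proof -
    have "card J \<le> CARD('n)" by (simp add: card_mono)
    moreover have "card J \<le> CARD('l)" using codim by (cases "card J \<le> CARD('l)") auto
    ultimately obtain a b where ab: "CARD('n) = card J + a" "CARD('l) = card J + b"
      by (metis le_Suc_ex)
    show ?thesis using codim dimVW unfolding ab by (simp add: algebra_simps)
  qed
  finally have dimT: "dim ?T < DIM(real ^ 'm ^ 'l)" by (simp add: mult.commute)
  have "\<Phi> differentiable_on ?S"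
    unfolding differentiable_on_def
  proof
    fix p assume p: "p \<in> ?S"
    let ?F = "at p within ?S"
    have x: "fst differentiable ?F" and Y: "(\<lambda>p. fst (snd p)) differentiable ?F"
      and C: "(\<lambda>p. fst (snd (snd p))) differentiable ?F"
      and W: "(\<lambda>p. snd (snd (snd p))) differentiable ?F"
      by (auto intro!: linear_imp_differentiable linearI)
    have lift: "(\<lambda>p. H (fst p)) differentiable ?F" if "H differentiable (at (fst p) within D)"
      for H :: "real ^ 'n \<Rightarrow> 'z::euclidean_space"
    proof -
      have "fst ` ?S = D" using p by force
      then show ?thesis using differentiable_chain_within[OF x, of H] that by (simp add: o_def)
    qed
    have D: "fst p \<in> D" "D \<subseteq> V" using p by (auto simp: D_def)
    have dB: "B differentiable (at (fst p) within D)" and dG: "G differentiable (at (fst p) within D)"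
      using B G D by (blast intro: differentiable_within_subset)+
    have dT: "T differentiable (at (fst p) within D)"
      unfolding T_def
      by (rule differentiable_matrix_inv[OF differentiable_matrix_mult[OF differentiable_const dB] D(1)])
        (simp add: D_def)
    show "\<Phi> differentiable ?F"
      unfolding \<Phi>_def split_beta
      by (intro differentiable_add differentiable_diff differentiable_matrix_mult differentiable_const
          Y C W lift dB dG dT)
  qed
  moreover have "subspace ?T" using sub by (simp add: subspace_Times)
  ultimately have "negligible (\<Phi> ` ?S)"
    using dimT by (intro negligible_differentiable_image_subspace) auto
  moreover have "?bad \<subseteq> \<Phi> ` ?S"
  proof clarify
    fix P x Y C
    assume x: "x \<in> V" "det (L ** B x) \<noteq> 0"
      and Y: "\<forall>i j. (i, j) \<notin> UNIV \<times> J \<longrightarrow> Y $ i $ j = 0"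
      and C: "\<forall>i j. (i, j) \<notin> J \<times> - J \<longrightarrow> C $ i $ j = 0"
      and M: "G x + P ** B x = Y ** (mat 1 + C)"
    define W where "W = P - P ** (K ** L)"
    have LBT: "L ** (B x ** (T x ** Z)) = Z" for Z :: "real ^ 'm ^ 'n"
      using x(2) by (simp add: T_def matrix_mul_assoc matrix_inv_inverse)
    have "W \<in> VW"
      by (simp add: VW_def W_def matrix_diff_rdistrib matrix_mul_assoc[symmetric] K)
    moreover have "\<Phi> (x, Y, C, W) = P"
    proof -
      have "W ** (B x ** (T x ** L)) = P ** (B x ** (T x ** L)) - P ** (K ** L)"
        by (simp add: W_def matrix_diff_rdistrib matrix_mul_assoc[symmetric] LBT)
      then have "W - W ** (B x ** (T x ** L)) = P - P ** (B x ** (T x ** L))"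
        by (simp add: W_def)
      moreover have "(Y ** (mat 1 + C) - G x) ** (T x ** L) = P ** (B x ** (T x ** L))"
        by (simp add: M[symmetric] matrix_mul_assoc[symmetric])
      ultimately show ?thesis by (simp add: \<Phi>_def add_diff_eq[symmetric])
    qed
    ultimately show "P \<in> \<Phi> ` ?S"
      using x Y C by (intro image_eqI[of _ _ "(x, Y, C, W)"]) (auto simp: D_def VY_def VC_def)
  qed
  ultimately show ?thesis by (rule negligible_subset)
qed

text \<open>
  As \<open>B x\<close> is injective, the matrices \<open>L\<close> with \<open>L ** B x\<close> invertible form a nonempty open set, which
  meets a fixed countable dense set of matrices. So countably many choices of \<open>L\<close> and \<open>J\<close> cover all
  points \<open>x\<close> and all ranks.
\<close>

lemma negligible_low_rank:
  fixes B :: "real ^ 'n::finite \<Rightarrow> real ^ 'n ^ 'm::finite" and G :: "real ^ 'n \<Rightarrow> real ^ 'n ^ 'l::finite"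
  assumes B: "\<And>x. x \<in> V \<Longrightarrow> B differentiable (at x within V)"
    and G: "\<And>x. x \<in> V \<Longrightarrow> G differentiable (at x within V)"
    and inj: "\<And>x. x \<in> V \<Longrightarrow> inj ((*v) (B x))"
  shows "negligible {P :: real ^ 'm ^ 'l. \<exists>x\<in>V.
    CARD('n) < (CARD('n) - rank (G x + P ** B x)) * (CARD('l) - rank (G x + P ** B x))}"
    (is "negligible ?bad")
proof -
  obtain D :: "(real ^ 'm ^ 'n) set" where D: "countable D" "\<And>E. open E \<Longrightarrow> E \<noteq> {} \<Longrightarrow> \<exists>L\<in>D. L \<in> E"
    using countable_dense_exists[where 'a="real ^ 'm ^ 'n"] by blast
  define S where "S = (\<lambda>(L, J). {P :: real ^ 'm ^ 'l. \<exists>x\<in>V. det (L ** B x) \<noteq> 0 \<and>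
    (\<exists>Y C. (\<forall>i j. (i, j) \<notin> UNIV \<times> J \<longrightarrow> Y $ i $ j = 0) \<and>
      (\<forall>i j. (i, j) \<notin> J \<times> - J \<longrightarrow> C $ i $ j = 0) \<and> G x + P ** B x = Y ** (mat 1 + C))})"
  define I where "I = D \<times> {J :: 'n set. CARD('n) < (CARD('n) - card J) * (CARD('l) - card J)}"
  have "negligible (\<Union> (S ` I))"
  proof (rule negligible_countable_Union)
    show "countable (S ` I)" using D(1) by (auto simp: I_def intro: countable_finite)
    show "negligible s" if "s \<in> S ` I" for s
      using that negligible_rank_stratum[OF B G] by (auto simp: I_def S_def)
  qed
  moreover have "?bad \<subseteq> \<Union> (S ` I)"
  proof clarify
    fix P :: "real ^ 'm ^ 'l" and x
    let ?M = "G x + P ** B x"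
    assume x: "x \<in> V" and r: "CARD('n) < (CARD('n) - rank ?M) * (CARD('l) - rank ?M)"
    obtain L0 where "L0 ** B x = mat 1"
      using inj[OF x] matrix_left_invertible_injective by blast
    then have "L0 \<in> {L. det (L ** B x) \<noteq> 0}" by simp
    moreover have "open {L. det (L ** B x) \<noteq> 0}"
    proof -
      have "continuous_on UNIV (\<lambda>L. det (L ** B x))"
        by (intro differentiable_imp_continuous_on)
          (auto simp: differentiable_on_def intro!: differentiable_det differentiable_matrix_mult)
      then show ?thesis by (intro open_Collect_neq) auto
    qed
    ultimately obtain L where L: "L \<in> D" "det (L ** B x) \<noteq> 0" using D(2) by blast
    obtain J where J: "card J = rank ?M"
      "\<exists>Y C. (\<forall>i j. (i, j) \<notin> UNIV \<times> J \<longrightarrow> Y $ i $ j = 0) \<and>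
        (\<forall>i j. (i, j) \<notin> J \<times> - J \<longrightarrow> C $ i $ j = 0) \<and> ?M = Y ** (mat 1 + C)"
      using rank_factorization[of ?M] by blast
    have "(L, J) \<in> I" using L r J by (simp add: I_def)
    moreover have "P \<in> S (L, J)"
      unfolding S_def using x L(2) J(2) by blast
    ultimately show "P \<in> \<Union> (S ` I)" by blast
  qed
  ultimately show ?thesis by (rule negligible_subset)
qed

section \<open>Differentials in charts\<close>

lemma smooth_on_imp_frechet_derivative_differentiable:
  assumes "smooth_on S f" "x \<in> S"
  shows "(\<lambda>y. frechet_derivative f (at y) v) differentiable (at x)"
proof -
  have "Ck_on (Suc (Suc 0)) S f" using assms(1) by (simp only: smooth_on_def)
  then show ?thesis using assms(2) by (simp only: Ck_on.simps)
qed

lemma smooth_on_imp_jacobian_differentiable: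
  fixes f :: "real ^ 'n::finite \<Rightarrow> real ^ 'm::finite"
  assumes "smooth_on S f" "x \<in> S"
  shows "(\<lambda>y. matrix (frechet_derivative f (at y))) differentiable (at x)"
  unfolding differentiable_matrix_iff matrix_def
proof (intro allI)
  fix i j
  have "(\<lambda>y. frechet_derivative f (at y) (axis j 1) $ i) differentiable (at x)"
    using smooth_on_imp_frechet_derivative_differentiable[OF assms, of "axis j 1"]
    unfolding differentiable_componentwise_within[of "\<lambda>y. frechet_derivative f (at y) (axis j 1)"]
    by (auto simp: Basis_vec_def inner_axis)
  then show "(\<lambda>y. (\<chi> i j. frechet_derivative f (at y) (axis j 1) $ i) $ i $ j) differentiable (at x)"
    by simp
qed

context smooth_manifold
begin

lemma transition_at:
  assumes "c \<in> charts_at A q" "d \<in> charts_at A q"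
  shows "in_chart c (snd d) (snd c q) = snd d q"
    and "in_chart c (snd d) differentiable (at (snd c q))"
    and "\<forall>\<^sub>F x in nhds (snd c q). in_chart d g (in_chart c (snd d) x) = in_chart c g x"
proof -
  have c: "c \<in> A" "q \<in> fst c" and d: "d \<in> A" "q \<in> fst d"
    using assms by (auto simp: charts_at_def)
  have inv: "inv_into (fst e) (snd e) (snd e p) = p" if "e \<in> A" "p \<in> fst e" for e p
    using inj_on_chart[OF that(1)] that(2) by (rule inv_into_f_f)
  show "in_chart c (snd d) (snd c q) = snd d q" using inv c by (simp add: in_chart_def)
  show "in_chart c (snd d) differentiable (at (snd c q))"
    using smooth_transition[OF c(1) d(1)] c d by (intro smooth_on_imp_differentiable) auto
  show "\<forall>\<^sub>F x in nhds (snd c q). in_chart d g (in_chart c (snd d) x) = in_chart c g x"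
    unfolding eventually_nhds
    using open_overlap[OF c(1) d(1)] c d
    by (intro exI[of _ "snd c ` (fst c \<inter> fst d)"]) (auto simp: in_chart_def inv)
qed

text \<open>
  Differentiability is asked of \<open>g\<close> only at one point of one chart, so that the lemma applies to
  transition maps, and to the perturbed map without first proving it smooth on the manifold.
\<close>

lemma frechet_derivative_change_of_chart:
  fixes g :: "'a \<Rightarrow> 'b::euclidean_space"
  assumes c: "c \<in> charts_at A q" and d: "d \<in> charts_at A q"
    and g: "in_chart d g differentiable (at (snd d q))"
  shows "frechet_derivative (in_chart c g) (at (snd c q)) =
    frechet_derivative (in_chart d g) (at (snd d q)) \<circ>
      frechet_derivative (in_chart c (snd d)) (at (snd c q))"
proof -
  note t = transition_at[OF c d]
  have "(in_chart d g has_derivative frechet_derivative (in_chart d g) (at (snd d q)))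
      (at (in_chart c (snd d) (snd c q)))"
    using g unfolding t(1) by (rule frechet_derivative_works[THEN iffD1])
  from diff_chain_at[OF t(2)[THEN frechet_derivative_works[THEN iffD1]] this]
  have "(in_chart c g has_derivative frechet_derivative (in_chart d g) (at (snd d q)) \<circ>
      frechet_derivative (in_chart c (snd d)) (at (snd c q))) (at (snd c q))"
    by (rule has_derivative_transform_eventually)
      (use t(3) eventually_nhds_x_imp_x[OF t(3)] in \<open>auto simp: eventually_nhds_conv_at o_def\<close>)
  then show ?thesis by (rule frechet_derivative_at[symmetric])
qed

text \<open>
  The coordinate vector in one chart can be prescribed: transporting it by the Jacobians of the
  transition maps is consistent by the chain rule.
\<close>

lemma tangent_vector_exists:
  assumes c: "c \<in> charts_at A q"
  obtains v where "v \<in> tangent_space A q" "v c = w"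
proof -
  define v where "v = (\<lambda>d\<in>charts_at A q. frechet_derivative (in_chart c (snd d)) (at (snd c q)) w)"
  have "v e = frechet_derivative (in_chart d (snd e)) (at (snd d q)) (v d)"
    if "d \<in> charts_at A q" "e \<in> charts_at A q" for d e
    using that frechet_derivative_change_of_chart[OF c that(1) transition_at(2)[OF that]]
    by (simp add: v_def)
  moreover have "v \<in> extensional (charts_at A q)" by (simp add: v_def)
  ultimately have "v \<in> tangent_space A q" unfolding tangent_space_def by blast
  moreover have "v c = w"
  proof -
    have cA: "c \<in> A" "q \<in> fst c" using c by (auto simp: charts_at_def)
    have "((\<lambda>x. x) has_derivative (\<lambda>x. x)) (at (snd c q))" by (rule has_derivative_ident)
    then have "(in_chart c (snd c) has_derivative (\<lambda>x. x)) (at (snd c q))"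
    proof (rule has_derivative_transform_within_open)
      show "open (snd c ` fst c)" using open_range cA by blast
      show "snd c q \<in> snd c ` fst c" using cA by blast
      show "x = in_chart c (snd c) x" if "x \<in> snd c ` fst c" for x
        using that by (simp add: in_chart_def f_inv_into_f)
    qed
    then show ?thesis using c by (simp add: v_def frechet_derivative_at[symmetric])
  qed
  ultimately show ?thesis by (rule that)
qed

text \<open>
  The counterpart of \<open>differential_eq\<close> for a map \<open>g\<close> about which only differentiability at \<open>q\<close>
  is known.
\<close>

lemma differential_in_chart:
  fixes g :: "'a \<Rightarrow> 'b::euclidean_space"
  assumes v: "v \<in> tangent_space A q" and c: "c \<in> charts_at A q"
    and g: "in_chart c g differentiable (at (snd c q))"
  shows "differential A g q v = frechet_derivative (in_chart c g) (at (snd c q)) (v c)"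
proof -
  define d where "d = (SOME c. c \<in> charts_at A q)"
  have d: "d \<in> charts_at A q" unfolding d_def using c by (rule someI)
  have "v c = frechet_derivative (in_chart d (snd c)) (at (snd d q)) (v d)"
    using v c d unfolding tangent_space_def by blast
  then show ?thesis
    using frechet_derivative_change_of_chart[OF d c g]
    by (simp add: differential_def d_def[symmetric])
qed

lemma range_differential:
  fixes g :: "'a \<Rightarrow> 'b::euclidean_space"
  assumes c: "c \<in> charts_at A q" and g: "in_chart c g differentiable (at (snd c q))"
  shows "differential A g q ` tangent_space A q =
    range (frechet_derivative (in_chart c g) (at (snd c q)))"
proof
  let ?D = "frechet_derivative (in_chart c g) (at (snd c q))"
  note eq = differential_in_chart[OF _ c g]
  show "differential A g q ` tangent_space A q \<subseteq> range ?D"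
    using eq by blast
  show "range ?D \<subseteq> differential A g q ` tangent_space A q"
  proof (rule image_subsetI)
    fix w
    obtain v where "v \<in> tangent_space A q" "v c = w"
      using tangent_vector_exists[OF c] .
    then show "?D w \<in> differential A g q ` tangent_space A q"
      using eq[of v] by (intro image_eqI[of _ _ v]) simp_all
  qed
qed

lemma inj_differential:
  fixes g :: "'a \<Rightarrow> 'b::euclidean_space"
  assumes c: "c \<in> charts_at A q" and g: "in_chart c g differentiable (at (snd c q))"
    and inj: "inj_on (differential A g q) (tangent_space A q)"
  shows "inj (frechet_derivative (in_chart c g) (at (snd c q)))"
proof (rule injI)
  fix w w'
  assume eq: "frechet_derivative (in_chart c g) (at (snd c q)) w =
    frechet_derivative (in_chart c g) (at (snd c q)) w'"
  obtain v where v: "v \<in> tangent_space A q" "v c = w"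
    using tangent_vector_exists[OF c] .
  obtain v' where v': "v' \<in> tangent_space A q" "v' c = w'"
    using tangent_vector_exists[OF c] .
  have "differential A g q v = differential A g q v'"
    using eq differential_in_chart[OF v(1) c g] differential_in_chart[OF v'(1) c g]
    unfolding v(2) v'(2) by (metis (no_types))
  then have "v = v'" by (rule inj_onD[OF inj _ v(1) v'(1)])
  then show "w = w'" using v(2) v'(2) by simp
qed

section \<open>The exceptional perturbations\<close>

text \<open>
  Null sets are stable under countable unions only, so the estimates in single charts need this.
\<close>

lemma countable_subatlas:
  obtains A' where "countable A'" "A' \<subseteq> A" "topspace X = (\<Union>c\<in>A'. fst c)"
proof -
  have "Lindelof_space X" using second_countable by (rule second_countable_imp_Lindelof_space)
  moreover have "\<forall>U\<in>fst ` A. openin X U" "\<Union> (fst ` A) = topspace X"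
    using openin_domain domains_cover by auto
  ultimately obtain V where V: "countable V" "V \<subseteq> fst ` A" "\<Union> V = topspace X"
    unfolding Lindelof_space_def by meson
  obtain A' where "countable A'" "A' \<subseteq> A" "V = fst ` A'"
    using countable_subset_image[of V fst A] V(1,2) by blast
  then show ?thesis using V(3) by (intro that) auto
qed

text \<open>
  The perturbation enters the derivative through the product of its matrix with the Jacobian of
  \<open>f\<close>; this is the form \<open>G x + P ** B x\<close> of the matrix estimates.
\<close>

lemma rank_perturbed_differential:
  fixes F :: "real ^ 'm::finite \<Rightarrow> real ^ 'l::finite"
  assumes c: "c \<in> charts_at A q" and f: "in_chart c f differentiable (at (snd c q))"
    and F: "F differentiable (at (f q))" and \<pi>: "linear \<pi>"
  shows "dim (differential A (perturb F \<pi> \<circ> f) q ` tangent_space A q) =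
      rank (matrix (frechet_derivative F (at (f q))) **
          matrix (frechet_derivative (in_chart c f) (at (snd c q))) +
        matrix \<pi> ** matrix (frechet_derivative (in_chart c f) (at (snd c q))))"
proof -
  let ?f' = "frechet_derivative (in_chart c f) (at (snd c q))"
    and ?F' = "frechet_derivative F (at (f q))"
  have cA: "c \<in> A" "q \<in> fst c" using c by (auto simp: charts_at_def)
  have fq: "in_chart c f (snd c q) = f q"
    using inv_into_f_f[OF inj_on_chart] cA by (simp add: in_chart_def)
  have f': "(in_chart c f has_derivative ?f') (at (snd c q))"
    using f by (rule frechet_derivative_works[THEN iffD1])
  have F': "(F has_derivative ?F') (at (f q))"
    using F by (rule frechet_derivative_works[THEN iffD1])
  have "(perturb F \<pi> has_derivative (\<lambda>y. ?F' y + \<pi> y)) (at (in_chart c f (snd c q)))"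
    unfolding perturb_def fq using F' linear_imp_has_derivative[OF \<pi>] by (rule has_derivative_add)
  from diff_chain_at[OF f' this]
  have g': "(in_chart c (perturb F \<pi> \<circ> f) has_derivative (\<lambda>y. ?F' y + \<pi> y) \<circ> ?f') (at (snd c q))"
    unfolding in_chart_def comp_assoc .
  then have diff: "in_chart c (perturb F \<pi> \<circ> f) differentiable (at (snd c q))"
    by (auto simp: differentiable_def)
  have lin: "linear ?f'" "linear ?F'"
    using has_derivative_linear f' F' by blast+
  have "((\<lambda>y. ?F' y + \<pi> y) \<circ> ?f') w = (matrix ?F' ** matrix ?f' + matrix \<pi> ** matrix ?f') *v w" for w
    using lin \<pi>
    by (simp add: matrix_vector_mult_add_rdistrib matrix_vector_mul_assoc[symmetric] fun_cong[OF matrix_vector_mul(2)])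
  then have "(\<lambda>y. ?F' y + \<pi> y) \<circ> ?f' = (*v) (matrix ?F' ** matrix ?f' + matrix \<pi> ** matrix ?f')"
    by blast
  then show "dim (differential A (perturb F \<pi> \<circ> f) q ` tangent_space A q) =
      rank (matrix ?F' ** matrix ?f' + matrix \<pi> ** matrix ?f')"
    unfolding range_differential[OF c diff] frechet_derivative_at[OF g', symmetric]
    by (simp add: rank_dim_range)
qed

lemma negligible_low_rank_perturbations:
  fixes f :: "'a \<Rightarrow> real ^ 'm::finite" and F :: "real ^ 'm \<Rightarrow> real ^ 'l::finite"
  assumes f: "immersion_into X A f U" and F: "smooth_on U F"
  defines "r \<pi> q \<equiv> dim (differential A (perturb F \<pi> \<circ> f) q ` tangent_space A q)"
  shows "negligible (matrix ` {\<pi>. linear \<pi> \<and>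
    (\<exists>q\<in>topspace X. CARD('n) < (CARD('n) - r \<pi> q) * (CARD('l) - r \<pi> q))})"
    (is "negligible (matrix ` ?bad)")
proof -
  obtain A' where A': "countable A'" "A' \<subseteq> A" "topspace X = (\<Union>c\<in>A'. fst c)"
    using countable_subatlas .
  define B where "B c x = matrix (frechet_derivative (in_chart c f) (at x))"
    for c :: "('a, 'n) chart" and x
  define G where "G c x = matrix (frechet_derivative F (at (in_chart c f x))) ** B c x"
    for c :: "('a, 'n) chart" and x
  define S where "S c = {P :: real ^ 'm ^ 'l. \<exists>x\<in>snd c ` fst c.
    CARD('n) < (CARD('n) - rank (G c x + P ** B c x)) * (CARD('l) - rank (G c x + P ** B c x))}"
    for c :: "('a, 'n) chart"
  have in_chart_f: "in_chart c f (snd c q) = f q" if "c \<in> A" "q \<in> fst c" for c q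
    using inv_into_f_f[OF inj_on_chart] that by (simp add: in_chart_def)
  have fU: "f q \<in> U" if "c \<in> A" "q \<in> fst c" for c q
    using f that domains_cover by (auto simp: immersion_into_def)
  have smooth: "smooth_on (snd c ` fst c) (in_chart c f)" if "c \<in> A" for c
    using f that by (simp add: immersion_into_def smooth_map_def)
  have diff: "in_chart c f differentiable (at (snd c q))" if "c \<in> A" "q \<in> fst c" for c q
    using smooth_on_imp_differentiable[OF smooth[OF that(1)]] that(2) by blast
  have "negligible (\<Union> (S ` A'))"
  proof (rule negligible_countable_Union)
    show "countable (S ` A')" using A'(1) by simp
    fix s assume "s \<in> S ` A'"
    then obtain c where c: "c \<in> A" and s: "s = S c" using A'(2) by auto
    show "negligible s"
      unfolding s S_def
    proof (rule negligible_low_rank)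
      fix x assume "x \<in> snd c ` fst c"
      then obtain q where q: "q \<in> fst c" "x = snd c q" by blast
      have B: "B c differentiable (at x)"
        unfolding B_def using smooth[OF c] q by (intro smooth_on_imp_jacobian_differentiable) auto
      then show "B c differentiable (at x within snd c ` fst c)"
        by (rule differentiable_at_withinI)
      have "(\<lambda>y. matrix (frechet_derivative F (at y))) differentiable (at (in_chart c f x))"
        using smooth_on_imp_jacobian_differentiable[OF F fU[OF c q(1)]] in_chart_f[OF c q(1)] q(2) by simp
      moreover have "in_chart c f differentiable (at x)" using diff[OF c q(1)] q(2) by simp
      ultimately have "((\<lambda>y. matrix (frechet_derivative F (at y))) \<circ> in_chart c f) differentiable (at x)"
        by (intro differentiable_chain_at)
      from differentiable_matrix_mult[OF this B]
      have "G c differentiable (at x)" by (simp add: G_def[abs_def] o_def)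
      then show "G c differentiable (at x within snd c ` fst c)"
        by (rule differentiable_at_withinI)
      have cq: "c \<in> charts_at A q" "q \<in> topspace X"
        using c q domains_cover by (auto simp: charts_at_def)
      then have "inj (frechet_derivative (in_chart c f) (at x))"
        using inj_differential[OF cq(1) diff[OF c q(1)]] f q by (simp add: immersion_into_def)
      moreover have "linear (frechet_derivative (in_chart c f) (at x))"
        using diff[OF c q(1)] q by (simp add: linear_frechet_derivative)
      ultimately show "inj ((*v) (B c x))" by (simp add: B_def)
    qed
  qed
  moreover have "matrix ` ?bad \<subseteq> \<Union> (S ` A')"
  proof clarify
    fix \<pi> q assume \<pi>: "linear \<pi>" and q: "q \<in> topspace X"
      and r: "CARD('n) < (CARD('n) - r \<pi> q) * (CARD('l) - r \<pi> q)"
    obtain c where c: "c \<in> A'" "q \<in> fst c" using q A'(3) by blast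
    then have cA: "c \<in> A" and cq: "c \<in> charts_at A q" using A'(2) by (auto simp: charts_at_def)
    have "F differentiable (at (f q))"
      using F fU[OF cA c(2)] by (rule smooth_on_imp_differentiable)
    from rank_perturbed_differential[OF cq diff[OF cA c(2)] this \<pi>]
    have "r \<pi> q = rank (G c (snd c q) + matrix \<pi> ** B c (snd c q))"
      by (simp add: r_def G_def B_def in_chart_f[OF cA c(2)])
    then have "matrix \<pi> \<in> S c" using r c(2) by (auto simp: S_def)
    then show "matrix \<pi> \<in> \<Union> (S ` A')" using c(1) by blast
  qed
  ultimately show ?thesis by (rule negligible_subset)
qed

end

section \<open>The bound on the corank\<close>

text \<open>
  The maximum exists because \<open>k * k \<le> (a + k) * (b + k)\<close> bounds the nonnegative candidates \<open>k\<close> by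
  \<open>n\<close>, and \<open>0\<close> is a candidate. Without this, \<open>GREATEST\<close> would be an unspecified integer.
\<close>

lemma Greatest_shifted_product:
  fixes a b n k0 :: int
  assumes a: "0 \<le> a" and b: "0 \<le> b" and ab: "a * b \<le> n"
    and k0: "k0 = (GREATEST k. (a + k) * (b + k) \<le> n)"
  shows "0 \<le> k0" and "\<And>k. k0 < k \<Longrightarrow> n < (a + k) * (b + k)"
proof -
  let ?P = "\<lambda>k. (a + k) * (b + k) \<le> n"
  have bound: "k \<le> n" if k: "0 \<le> k" "?P k" for k
  proof (cases "k = 0")
    case False
    have "k * 1 \<le> k * k" using False k(1) by (intro mult_left_mono) auto
    also have "\<dots> \<le> (a + k) * (b + k)" using a b k(1) by (intro mult_mono) auto
    finally show ?thesis using k(2) by simp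
  next
    case True
    have "0 \<le> a * b" using a b by simp
    then show ?thesis using True ab by linarith
  qed
  define S where "S = {k. 0 \<le> k \<and> ?P k}"
  have fin: "finite S"
    by (rule finite_subset[of _ "{0..n}"]) (use bound in \<open>auto simp: S_def\<close>)
  have "0 \<in> S" using ab by (simp add: S_def)
  then have max: "Max S \<in> S" using fin by (intro Max_in) auto
  have le: "k \<le> Max S" if "?P k" for k
  proof (cases "0 \<le> k")
    case True
    then have "k \<in> S" using that by (simp add: S_def)
    then show ?thesis using fin by (intro Max_ge)
  next
    case False
    then show ?thesis using max by (simp add: S_def)
  qed
  have "k0 = Max S"
    unfolding k0 by (rule Greatest_equality) (use max le in \<open>simp_all add: S_def\<close>)
  then show "0 \<le> k0" using max by (simp add: S_def)
  show "n < (a + k) * (b + k)" if "k0 < k" for k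
    using le[of k] that \<open>k0 = Max S\<close> by linarith
qed

theorem corollary4:
  fixes X :: "'a topology" and A :: "('a, 'n::finite) chart set"
    and U :: "(real ^ 'm::finite) set"
    and f :: "'a \<Rightarrow> real ^ 'm" and F :: "real ^ 'm \<Rightarrow> real ^ 'l::finite"
    and n l v k0 :: int
  assumes "smooth_manifold X A"
    and "open U"
    and "immersion_into X A f U"
    and "smooth_on U F"
    and "n = int CARD('n)" and "l = int CARD('l)" and "v = min n l"
    and "k0 = (GREATEST k. (n - v + k) * (l - v + k) \<le> n)"
  shows "\<exists>\<Sigma>. null_set_of_linear_maps \<Sigma> \<and>
    (\<forall>\<pi>. linear \<pi> \<and> \<pi> \<notin> \<Sigma> \<longrightarrow> corank_at_most_singular X A (perturb F \<pi> \<circ> f) k0)"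
proof -
  interpret smooth_manifold X A by fact
  let ?r = "\<lambda>\<pi> q. dim (differential A (perturb F \<pi> \<circ> f) q ` tangent_space A q)"
  define \<Sigma> where "\<Sigma> = {\<pi>. linear \<pi> \<and>
    (\<exists>q\<in>topspace X. CARD('n) < (CARD('n) - ?r \<pi> q) * (CARD('l) - ?r \<pi> q))}"
  have "0 \<le> n - v" "0 \<le> l - v" "(n - v) * (l - v) \<le> n"
    using assms(5-7) by (auto simp: min_def)
  note k0 = Greatest_shifted_product[OF this assms(8)]
  have "null_set_of_linear_maps \<Sigma>"
    using negligible_low_rank_perturbations[OF assms(3,4)]
    by (auto simp: null_set_of_linear_maps_def negligible_iff_null_sets \<Sigma>_def)
  moreover have "corank_at_most_singular X A (perturb F \<pi> \<circ> f) k0"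
    if \<pi>: "linear \<pi>" "\<pi> \<notin> \<Sigma>" for \<pi>
  proof -
    let ?g = "perturb F \<pi> \<circ> f"
    have "corank A ?g q \<le> nat k0" if q: "q \<in> topspace X" for q
    proof (rule ccontr)
      assume "\<not> corank A ?g q \<le> nat k0"
      then have k: "k0 < int (corank A ?g q)" by linarith
      then have r: "int (corank A ?g q) = v - int (?r \<pi> q)" "int (?r \<pi> q) \<le> v"
        using k0(1) assms(5-7) by (auto simp: corank_def)
      \<comment> \<open>Corank \<open>k\<close> means rank \<open>v - k\<close>, so \<open>n - v + k\<close> and \<open>l - v + k\<close> are the dimensions
        of the kernel and of the cokernel.\<close>
      have "n < (n - int (?r \<pi> q)) * (l - int (?r \<pi> q))"
        using k0(2)[OF k] unfolding r(1) by simp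
      also have "\<dots> = int ((CARD('n) - ?r \<pi> q) * (CARD('l) - ?r \<pi> q))"
        using r(2) assms(5-7) by (simp add: of_nat_diff)
      finally have "\<pi> \<in> \<Sigma>"
        using \<pi>(1) q unfolding \<Sigma>_def assms(5) of_nat_less_iff by blast
      then show False using \<pi>(2) by contradiction
    qed
    then have "(SUP q\<in>topspace X. corank A ?g q) \<le> nat k0"
      by (cases "topspace X = {}") (auto intro: cSUP_least)
    then show ?thesis using k0(1) by (simp add: corank_at_most_singular_def)
  qed
  ultimately show ?thesis by blast
qed

end
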